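(* For $\mu>0$ and $w\in\mathrm{int}\,\mathcal{K}$, let \[ d_1=\mathrm{proj}_{\mathcal{L}_w^\perp}\Big(Q(w^{-1/2})\big(\tfrac1{\sqrt\mu}x_0-w\big)\Big),\qquad d_2=\mathrm{proj}_{\mathcal{L}_w}\Big(Q(w^{1/2})\big(\tfrac1{\sqrt\mu}s_0-w^{-1}\big)\Big). \] Then the Newton direction satisfies $d_N(w,\mu)=d_1-d_2$.
   Context: Setting. $\mathcal{J}$ is a (finite-dimensional real) Euclidean Jordan algebra of rank $n$ with product $\circ$, identity $e$, trace $\mathrm{tr}$, inner product $\langle u,v\rangle=\mathrm{tr}(u\circ v)$. $\mathcal{K}=\{u\circ u:u\in\mathcal{J}\}$ is its cone of squares, with interior $\mathrm{int}\,\mathcal{K}$. Functions such as $u^{1/2}$, $u^{-1}$ are applied spectrally. $Q(u)v:=2u\circ(u\circ v)-(u\circ u)\circ v$. $\mathcal{L}\subseteq\mathcal{J}$ is a linear subspace with orthogonal complement $\mathcal{L}^\perp$, and $x_0,s_0\in\mathcal{J}$. Standing assumption (Slater): $\mathrm{int}\,\mathcal{K}\cap(x_0+\mathcal{L})\neq\emptyset$ and $\mathrm{int}\,\mathcal{K}\cap(s_0+\mathcal{L}^\perp)\ne\emptyset$. For $w\in\mathrm{int}\,\mathcal{K}$, $\mathcal{L}_w:=\{Q(w^{-1/2})u:u\in\mathcal{L}\}$, whose orthogonal complement is $\mathcal{L}_w^\perp=\{Q(w^{1/2})u:u\in\mathcal{L}^\perp\}$; $\mathrm{proj}$ denotes orthogonal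 projection. Newton direction. For $w\in\mathrm{int}\,\mathcal{K}$ and $\mu>0$, $d_N(w,\mu)$ is the unique $d\in\mathcal{J}$ with $Q(w^{1/2})(e+d)\in\frac1{\sqrt\mu}x_0+\mathcal{L}$ and $Q(w^{-1/2})(e-d)\in\frac1{\sqrt\mu}s_0+\mathcal{L}^\perp$. *)

theory Defs
  imports "HOL-Analysis.Analysis"
begin

text \<open>
  The ambient vector space is a type of class \<open>euclidean_space\<close>; the Jordan product \<open>P\<close> and
  the identity \<open>e\<close> are explicit parameters.
\<close>

subsection \<open>Idempotents, spectral decompositions, rank and trace\<close>

definition jordan_idempotent :: "('a::euclidean_space \<Rightarrow> 'a \<Rightarrow> 'a) \<Rightarrow> 'a \<Rightarrow> bool" where
  "jordan_idempotent P c \<longleftrightarrow> P c c = c"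

definition primitive_idempotent :: "('a::euclidean_space \<Rightarrow> 'a \<Rightarrow> 'a) \<Rightarrow> 'a \<Rightarrow> bool" where
  "primitive_idempotent P c \<longleftrightarrow> jordan_idempotent P c \<and> c \<noteq> 0 \<and>
     \<not> (\<exists>a b. jordan_idempotent P a \<and> jordan_idempotent P b \<and> a \<noteq> 0 \<and> b \<noteq> 0 \<and> c = a + b)"

text \<open>Only the values \<open>c 0, \<dots>, c (k - 1)\<close> matter.\<close>

definition jordan_frame ::
  "('a::euclidean_space \<Rightarrow> 'a \<Rightarrow> 'a) \<Rightarrow> 'a \<Rightarrow> nat \<Rightarrow> (nat \<Rightarrow> 'a) \<Rightarrow> bool" where
  "jordan_frame P e k c \<longleftrightarrow>
     (\<forall>i<k. primitive_idempotent P (c i)) \<and>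
     (\<forall>i<k. \<forall>j<k. i \<noteq> j \<longrightarrow> P (c i) (c j) = 0) \<and>
     (\<Sum>i<k. c i) = e"

definition spectral_decomposition ::
  "('a::euclidean_space \<Rightarrow> 'a \<Rightarrow> 'a) \<Rightarrow> 'a \<Rightarrow> 'a \<Rightarrow> nat \<Rightarrow> (nat \<Rightarrow> real) \<Rightarrow> (nat \<Rightarrow> 'a) \<Rightarrow> bool" where
  "spectral_decomposition P e u k l c \<longleftrightarrow> jordan_frame P e k c \<and> u = (\<Sum>i<k. l i *\<^sub>R c i)"

text \<open>The value does not depend on the decomposition; in particular \<open>k\<close> is always the rank.\<close>

definition jordan_trace :: "('a::euclidean_space \<Rightarrow> 'a \<Rightarrow> 'a) \<Rightarrow> 'a \<Rightarrow> 'a \<Rightarrow> real" where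
  "jordan_trace P e u =
     (THE t. \<exists>k l c. spectral_decomposition P e u k l c \<and> t = (\<Sum>i<k. l i))"

definition jordan_apply ::
  "('a::euclidean_space \<Rightarrow> 'a \<Rightarrow> 'a) \<Rightarrow> 'a \<Rightarrow> (real \<Rightarrow> real) \<Rightarrow> 'a \<Rightarrow> 'a" where
  "jordan_apply P e f u =
     (THE v. \<exists>k l c. spectral_decomposition P e u k l c \<and> v = (\<Sum>i<k. f (l i) *\<^sub>R c i))"

definition jordan_power :: "('a::euclidean_space \<Rightarrow> 'a \<Rightarrow> 'a) \<Rightarrow> 'a \<Rightarrow> 'a \<Rightarrow> nat \<Rightarrow> 'a" where
  "jordan_power P e u k = (P u ^^ k) e"

text \<open>The degree of the minimal polynomial of \<open>u\<close>; the rank is the largest such degree.\<close>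

definition jordan_degree :: "('a::euclidean_space \<Rightarrow> 'a \<Rightarrow> 'a) \<Rightarrow> 'a \<Rightarrow> 'a \<Rightarrow> nat" where
  "jordan_degree P e u =
     (LEAST k. jordan_power P e u k \<in> span {jordan_power P e u i |i. i < k})"

definition jordan_rank :: "('a::euclidean_space \<Rightarrow> 'a \<Rightarrow> 'a) \<Rightarrow> 'a \<Rightarrow> nat" where
  "jordan_rank P e = Max (range (jordan_degree P e))"

subsection \<open>Euclidean Jordan algebras\<close>

locale euclidean_jordan_algebra =
  fixes P :: "'a::euclidean_space \<Rightarrow> 'a \<Rightarrow> 'a" and e :: 'a
  assumes bilinear: "bilinear P"
    and commute: "P u v = P v u"
    and jordan_identity: "P u (P (P u u) v) = P (P u u) (P u v)"
    and unit: "P e u = u"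
    and inner_assoc: "inner (P u v) w = inner v (P u w)"

text \<open>
  The inner product of the type is normalised to the trace form. The trace form of a Euclidean
  Jordan algebra is itself positive definite and associative, so this excludes no algebra.
\<close>

locale trace_euclidean_jordan_algebra = euclidean_jordan_algebra P e
  for P :: "'a::euclidean_space \<Rightarrow> 'a \<Rightarrow> 'a" and e :: 'a +
  assumes inner_eq_trace: "inner u v = jordan_trace P e (P u v)"

definition cone_of_squares :: "('a::euclidean_space \<Rightarrow> 'a \<Rightarrow> 'a) \<Rightarrow> 'a set" where
  "cone_of_squares P = {P u u |u. True}"

definition jordan_quad :: "('a::euclidean_space \<Rightarrow> 'a \<Rightarrow> 'a) \<Rightarrow> 'a \<Rightarrow> 'a \<Rightarrow> 'a" where
  "jordan_quad P u v = 2 *\<^sub>R P u (P u v) - P (P u u) v"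

definition jordan_sqrt :: "('a::euclidean_space \<Rightarrow> 'a \<Rightarrow> 'a) \<Rightarrow> 'a \<Rightarrow> 'a \<Rightarrow> 'a" where
  "jordan_sqrt P e = jordan_apply P e sqrt"

definition jordan_inv :: "('a::euclidean_space \<Rightarrow> 'a \<Rightarrow> 'a) \<Rightarrow> 'a \<Rightarrow> 'a \<Rightarrow> 'a" where
  "jordan_inv P e = jordan_apply P e inverse"

definition jordan_inv_sqrt :: "('a::euclidean_space \<Rightarrow> 'a \<Rightarrow> 'a) \<Rightarrow> 'a \<Rightarrow> 'a \<Rightarrow> 'a" where
  "jordan_inv_sqrt P e = jordan_apply P e (\<lambda>t. inverse (sqrt t))"

subsection \<open>The scaled subspace, projections and the Newton direction\<close>

definition scaled_subspace ::
  "('a::euclidean_space \<Rightarrow> 'a \<Rightarrow> 'a) \<Rightarrow> 'a \<Rightarrow> 'a set \<Rightarrow> 'a \<Rightarrow> 'a set" where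
  "scaled_subspace P e L w = {jordan_quad P (jordan_inv_sqrt P e w) u |u. u \<in> L}"

definition orth_proj :: "'a::euclidean_space set \<Rightarrow> 'a \<Rightarrow> 'a" where
  "orth_proj S x = (THE p. p \<in> S \<and> x - p \<in> orthogonal_comp S)"

definition affine_translate :: "'a::euclidean_space \<Rightarrow> 'a set \<Rightarrow> 'a set" where
  "affine_translate x S = {x + u |u. u \<in> S}"

definition newton_direction ::
  "('a::euclidean_space \<Rightarrow> 'a \<Rightarrow> 'a) \<Rightarrow> 'a \<Rightarrow> 'a set \<Rightarrow> 'a \<Rightarrow> 'a \<Rightarrow> 'a \<Rightarrow> real \<Rightarrow> 'a" where
  "newton_direction P e L x0 s0 w \<mu> =
     (THE d. jordan_quad P (jordan_sqrt P e w) (e + d)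
               \<in> affine_translate ((1 / sqrt \<mu>) *\<^sub>R x0) L \<and>
             jordan_quad P (jordan_inv_sqrt P e w) (e - d)
               \<in> affine_translate ((1 / sqrt \<mu>) *\<^sub>R s0) (orthogonal_comp L))"

end

theory Submission
  imports Defs
begin

text \<open>
  Put \<open>a = w\<^sup>1\<^sup>/\<^sup>2\<close> and \<open>b = w\<^sup>-\<^sup>1\<^sup>/\<^sup>2\<close>. Both \<open>Q(a)\<close> and \<open>Q(b)\<close> are self-adjoint,
  they are inverse to each other, \<open>Q(a) e = w\<close> and \<open>Q(b) e = w\<^sup>-\<^sup>1\<close>. With
  \<open>p = Q(b) (x\<^sub>0 / \<surd>\<mu> - w)\<close> and \<open>q = Q(a) (s\<^sub>0 / \<surd>\<mu> - w\<^sup>-\<^sup>1)\<close>, the two conditions on the Newton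
  direction \<open>d\<close> become \<open>d - p \<in> L\<^sub>w\<close> and \<open>d + q \<in> L\<^sub>w\<^sup>\<bottom>\<close>, which \<open>d\<^sub>1 - d\<^sub>2\<close> alone satisfies.

  The functional calculus rests on the spectral theorem: multiplication by \<open>x\<close> is self-adjoint on the
  span \<open>A\<close> of the powers of \<open>x\<close>, and by power associativity each of its eigenvectors in \<open>A\<close> spans an ideal
  of \<open>A\<close>. An orthogonal eigenbasis of \<open>A\<close> therefore consists of multiples of orthogonal idempotents. A
  system of orthogonal idempotents of maximal cardinality with \<open>x\<close> in its span is a Jordan frame.
\<close>


section \<open>Eigenvectors of self-adjoint maps on an invariant subspace\<close>

lemma self_adjoint_eigenvector:
  fixes f :: "'a::euclidean_space \<Rightarrow> 'a"
  assumes f: "linear f" and S: "subspace S" "f ` S \<subseteq> S" "S \<noteq> {0}"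
    and adj: "\<And>x y. x \<in> S \<Longrightarrow> y \<in> S \<Longrightarrow> inner (f x) y = inner x (f y)"
  obtains y l where "y \<in> S" "y \<noteq> 0" "f y = l *\<^sub>R y"
proof -
  \<comment> \<open>The quadratic form of \<open>f\<close> attains its maximum on the compact unit
    sphere of \<open>S\<close>; a maximiser \<open>y\<close> turns out to be an eigenvector whose
    eigenvalue is the maximum.\<close>
  let ?C = "sphere 0 1 \<inter> S"
  obtain z where z: "z \<in> S" "z \<noteq> 0"
    using S(1,3) subspace_0 by blast
  have "z /\<^sub>R norm z \<in> ?C"
    using z S(1) by (simp add: subspace_scale)
  moreover have "compact ?C"
    using S(1) by (intro compact_Int_closed closed_subspace) auto
  moreover have "continuous_on ?C (\<lambda>y. inner (f y) y)"
    using f by (intro continuous_on_inner linear_continuous_on continuous_on_id)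
      (simp add: linear_conv_bounded_linear)
  ultimately obtain y where y: "y \<in> ?C" "\<And>v. v \<in> ?C \<Longrightarrow> inner (f v) v \<le> inner (f y) y"
    using continuous_attains_sup[of ?C "\<lambda>y. inner (f y) y"] by blast
  define l where "l = inner (f y) y"
  have yy: "inner y y = 1" and yS: "y \<in> S"
    using y(1) by (auto simp: norm_eq_1)
  have le: "inner (f v) v \<le> l * inner v v" if "v \<in> S" for v
  proof (cases "v = 0")
    case False
    have "inner (f (v /\<^sub>R norm v)) (v /\<^sub>R norm v) \<le> l"
      unfolding l_def using that S(1) False by (intro y(2)) (simp add: subspace_scale)
    then have "inner (f v) v / (norm v)\<^sup>2 \<le> l"
      by (simp add: linear_cmul[OF f] power2_eq_square divide_inverse mult_ac)
    then show ?thesis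
      using False by (simp add: divide_le_eq power2_norm_eq_inner)
  qed (simp add: linear_0[OF f])
  define v where "v = f y - l *\<^sub>R y"
  define g where "g = l * inner v v - inner (f v) v"
  have fyS: "f y \<in> S"
    using S(2) yS by blast
  have vS: "v \<in> S"
    unfolding v_def using S(1) yS fyS by (intro subspace_diff subspace_scale)
  \<comment> \<open>Compare the two forms at \<open>y + t *\<^sub>R v\<close>, where
    \<open>v\<close> is the residual of the eigenvalue equation. The constant terms cancel, the
    linear term leaves \<open>2 * inner v v\<close>, and the quadratic terms are collected in
    \<open>g\<close>.\<close>
  have g: "2 * inner v v \<le> t * g" if "t > 0" for t
  proof -
    have eq: "inner (f v) y = inner (f y) v"
      using adj[OF vS yS] by (simp add: inner_commute)
    have "inner (f (y + t *\<^sub>R v)) (y + t *\<^sub>R v) \<le> l * inner (y + t *\<^sub>R v) (y + t *\<^sub>R v)"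
      using S(1) yS vS by (intro le subspace_add subspace_scale)
    then have "2 * t * (inner (f y) v - l * inner y v) \<le> t * (t * g)"
      using eq yy by (simp add: g_def linear_add[OF f] linear_cmul[OF f] l_def[symmetric]
          inner_add_left inner_add_right inner_commute[of v y] algebra_simps)
    also have "inner (f y) v - l * inner y v = inner v v"
      by (simp add: v_def inner_diff_left)
    finally show ?thesis
      using that by simp
  qed
  have "inner v v = 0"
  proof (rule ccontr)
    assume "inner v v \<noteq> 0"
    then have pos: "inner v v > 0"
      by simp
    \<comment> \<open>\<open>t = 1\<close> yields \<open>g > 0\<close>, which permits
      \<open>t = inner v v / g\<close>; there the bound reads
      \<open>2 * inner v v \<le> inner v v\<close>.\<close>
    have "2 * inner v v \<le> 1 * g"
      by (rule g) simp
    then have "g > 0"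
      using pos by linarith
    moreover have "2 * inner v v \<le> inner v v / g * g"
      using pos \<open>g > 0\<close> by (intro g divide_pos_pos)
    ultimately show False
      using pos by simp
  qed
  then have "f y = l *\<^sub>R y"
    by (simp add: v_def)
  then show thesis
    using that yS yy by fastforce
qed

text \<open>Induction on the dimension: after splitting off an eigenvector \<open>y\<close>, its
  orthogonal complement \<open>T\<close> within \<open>S\<close> is again invariant, since
  \<open>f\<close> is self-adjoint on \<open>S\<close>.\<close>

lemma self_adjoint_eigenbasis:
  fixes f :: "'a::euclidean_space \<Rightarrow> 'a"
  assumes "linear f" "subspace S" "f ` S \<subseteq> S"
    and "\<And>x y. x \<in> S \<Longrightarrow> y \<in> S \<Longrightarrow> inner (f x) y = inner x (f y)"
  shows "\<exists>B. finite B \<and> B \<subseteq> S \<and> 0 \<notin> B \<and> pairwise orthogonal B \<and> S \<subseteq> span B \<and>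
    (\<forall>b\<in>B. \<exists>l. f b = l *\<^sub>R b)"
  using assms(2-4)
proof (induction "dim S" arbitrary: S rule: less_induct)
  case less
  show ?case
  proof (cases "S = {0}")
    case True
    then show ?thesis
      by (intro exI[of _ "{}"]) simp
  next
    case False
    obtain y l where y: "y \<in> S" "y \<noteq> 0" "f y = l *\<^sub>R y"
      using self_adjoint_eigenvector[OF assms(1) less.prems(1,2) False less.prems(3)] by blast
    define T where "T = S \<inter> {x. orthogonal y x}"
    have T: "subspace T"
      unfolding T_def using less.prems(1) by (intro subspace_inter subspace_orthogonal_to_vector)
    have "f ` T \<subseteq> T"
    proof
      fix z assume "z \<in> f ` T"
      then obtain x where x: "z = f x" "x \<in> S" "inner y x = 0"
        by (auto simp: T_def orthogonal_def)
      then have "inner y z = 0"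
        using less.prems(3)[OF y(1) x(2)] by (simp add: y(3))
      then show "z \<in> T"
        using x less.prems(2) by (auto simp: T_def orthogonal_def)
    qed
    moreover have "dim T < dim S"
    proof (rule dim_psubset)
      have "y \<notin> T"
        using y(2) by (simp add: T_def orthogonal_def)
      then show "span T \<subset> span S"
        using T less.prems(1) y(1) by (auto simp: span_eq_iff[THEN iffD2] T_def)
    qed
    ultimately obtain B where B: "finite B" "B \<subseteq> T" "0 \<notin> B" "pairwise orthogonal B" "T \<subseteq> span B"
      "\<forall>b\<in>B. \<exists>l. f b = l *\<^sub>R b"
      using less.hyps[of T] T less.prems(3) unfolding T_def by auto
    have "S \<subseteq> span (insert y B)"
    proof
      fix x assume x: "x \<in> S"
      have "x - (inner y x / inner y y) *\<^sub>R y \<in> T"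
        using x y less.prems(1)
        by (simp add: T_def orthogonal_def inner_diff_right subspace_diff subspace_scale)
      then show "x \<in> span (insert y B)"
        using B(5) by (auto simp: span_insert)
    qed
    moreover have "pairwise orthogonal (insert y B)"
      using B(2,4) by (auto simp: T_def pairwise_insert orthogonal_commute)
    ultimately show ?thesis
      using B y by (intro exI[of _ "insert y B"]) (auto simp: T_def)
  qed
qed

section \<open>The linearized Jordan identity and multiplication by idempotents\<close>

context euclidean_jordan_algebra
begin

lemma prod_simps:
  "P (x + y) z = P x z + P y z" "P x (y + z) = P x y + P x z"
  "P (x - y) z = P x z - P y z" "P x (y - z) = P x y - P x z"
  "P (- x) y = - P x y" "P x (- y) = - P x y"
  "P (r *\<^sub>R x) y = r *\<^sub>R P x y" "P x (r *\<^sub>R y) = r *\<^sub>R P x y"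
  "P 0 y = 0" "P x 0 = 0"
  by (simp_all add: bilinear bilinear_ladd bilinear_radd bilinear_lsub bilinear_rsub
      bilinear_lneg bilinear_rneg bilinear_lmul bilinear_rmul bilinear_lzero bilinear_rzero)

lemma unit_right: "P u e = u"
  using unit commute by metis

lemma linear_prod: "linear (P x)"
  by (simp add: linear_iff prod_simps)

text \<open>Polarisation: the defect \<open>G\<close> of the Jordan identity is cubic in
  \<open>u\<close>, and the alternating sum over \<open>x\<close>, \<open>y\<close>,
  \<open>z\<close> isolates the part that is linear in each of them.\<close>

lemma jordan_identity_linearized:
  "P x (P (P y z) v) + P y (P (P z x) v) + P z (P (P x y) v)
    = P (P y z) (P x v) + P (P z x) (P y v) + P (P x y) (P z v)"
proof -
  define G where "G u = P u (P (P u u) v) - P (P u u) (P u v)" for u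
  have G0: "G u = 0" for u
    by (simp add: G_def jordan_identity)
  have "G (x + y + z) - G (x + y) - G (y + z) - G (x + z) + G x + G y + G z
    = 2 *\<^sub>R ((P x (P (P y z) v) + P y (P (P z x) v) + P z (P (P x y) v))
      - (P (P y z) (P x v) + P (P z x) (P y v) + P (P x y) (P z v)))"
    unfolding G_def
    by (simp add: prod_simps commute[of y x] commute[of z x] commute[of z y] algebra_simps scaleR_2)
  then show ?thesis
    by (simp add: G0)
qed

text \<open>The linearized identity, solved for one term and read as an identity of operators
  applied to \<open>z\<close>. It reduces multiplication by a triple product to multiplications by
  the factors and their pairwise products.\<close>

lemma prod_triple:
  "P (P (P x y) w) z = P (P x w) (P y z) + P (P y w) (P x z) + P (P x y) (P w z)
    - P x (P w (P y z)) - P y (P w (P x z))"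
proof -
  have "P (P (P x y) w) z = P z (P (P x y) w)" by (rule commute)
  moreover have "P x (P (P y z) w) = P x (P w (P y z))" "P y (P (P z x) w) = P y (P w (P x z))"
    "P (P y z) (P x w) = P (P x w) (P y z)" "P (P z x) (P y w) = P (P y w) (P x z)"
    "P (P x y) (P z w) = P (P x y) (P w z)"
    by (metis commute)+
  ultimately show ?thesis
    using jordan_identity_linearized[of x y z w] by (simp add: algebra_simps)
qed

lemma inner_prod_left: "inner (P u v) w = inner u (P v w)"
  by (metis inner_assoc commute)

lemma inner_prod_unit: "inner (P u v) e = inner u v"
  by (simp add: inner_prod_left unit_right)

text \<open>\<open>prod_triple\<close> with all three factors equal to \<open>c\<close>.
  Multiplication by \<open>c\<close> is thus a root of \<open>2 t^3 - 3 t^2 + t\<close>, whose zeros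
  are 0, 1/2 and 1.\<close>

lemma idempotent_cubic:
  assumes "P c c = c"
  shows "P c z = 3 *\<^sub>R P c (P c z) - 2 *\<^sub>R P c (P c (P c z))"
proof -
  have "3 *\<^sub>R v = v + v + v" for v :: 'a
    using scaleR_add_left[of 1 2 v] by (simp add: scaleR_2)
  then show ?thesis
    using prod_triple[of c c c z] assms by (simp add: scaleR_2 diff_diff_eq)
qed

text \<open>
  On the spectrum \<open>{0, 1/2, 1}\<close> of multiplication by an idempotent the polynomial
  \<open>8 t\<^sup>2 (1 - t)\<^sup>2 + t\<^sup>2 (2 t - 1)\<^sup>2\<close> equals \<open>t\<close>.
\<close>

lemma inner_idempotent_prod:
  assumes c: "P c c = c"
  shows "inner x (P c x) = 8 * (norm (P c x - P c (P c x)))\<^sup>2 + (norm (2 *\<^sub>R P c (P c x) - P c x))\<^sup>2"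
proof -
  define a b d where "a = P c x" and "b = P c a" and "d = P c b"
  have a: "a = 3 *\<^sub>R b - 2 *\<^sub>R d"
    unfolding a_def b_def d_def by (rule idempotent_cubic[OF c])
  have xb: "inner x b = inner a a" and xd: "inner x d = inner a b" and ad: "inner a d = inner b b"
    by (simp_all add: a_def b_def d_def inner_assoc)
  have "inner x a = 3 * inner x b - 2 * inner x d"
    by (subst a) (simp add: inner_diff_right)
  moreover have "inner a a = 3 * inner a b - 2 * inner a d"
    by (subst (2) a) (simp add: inner_diff_right)
  ultimately show ?thesis
    unfolding a_def[symmetric] b_def[symmetric] xb xd ad
    by (simp add: power2_norm_eq_inner inner_diff_left inner_diff_right inner_commute[of b a])
qed

lemma inner_idempotent_prod_nonneg: "P c c = c \<Longrightarrow> 0 \<le> inner x (P c x)"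
  by (simp add: inner_idempotent_prod)

text \<open>Both squares in \<open>inner_idempotent_prod\<close> vanish, so \<open>b\<close> equals
  \<open>P c x\<close> as well as half of it.\<close>

lemma inner_idempotent_prod_eq_0D:
  assumes "P c c = c" "inner x (P c x) = 0"
  shows "P c x = 0"
proof -
  define b where "b = P c (P c x)"
  have "8 * (norm (P c x - b))\<^sup>2 + (norm (2 *\<^sub>R b - P c x))\<^sup>2 = 0"
    using inner_idempotent_prod[OF assms(1), of x] assms(2) by (simp add: b_def)
  then have "(norm (P c x - b))\<^sup>2 = 0" "(norm (2 *\<^sub>R b - P c x))\<^sup>2 = 0"
    using zero_le_power2[of "norm (P c x - b)"] zero_le_power2[of "norm (2 *\<^sub>R b - P c x)"]
    by linarith+
  then have "b = P c x" "b + b = P c x"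
    by (simp_all add: scaleR_2)
  then show ?thesis
    by simp
qed

text \<open>For an idempotent \<open>z\<close>, associativity of the inner product gives
  \<open>inner z f = inner z (P f z)\<close>, which is nonnegative. The values for \<open>a\<close>
  and \<open>b\<close> add up to 0, so each is 0.\<close>

lemma idempotent_summand_annihilates:
  assumes a: "P a a = a" and b: "P b b = b" and f: "P f f = f" and 0: "P (a + b) f = 0"
  shows "P f a = 0"
proof -
  have eq: "inner z (P f z) = inner z f" if "P z z = z" for z
    by (metis that commute inner_assoc)
  have "inner a f + inner b f = inner (P (a + b) f) e"
    by (simp only: inner_prod_unit inner_add_left)
  then have "inner a f + inner b f = 0"
    by (simp add: 0)
  then have "inner a (P f a) = 0"
    using inner_idempotent_prod_nonneg[OF f, of a] inner_idempotent_prod_nonneg[OF f, of b]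
    by (simp add: eq a b)
  then show ?thesis
    by (rule inner_idempotent_prod_eq_0D[OF f])
qed

section \<open>Power associativity\<close>

lemma jordan_power_0: "jordan_power P e x 0 = e"
  by (simp add: jordan_power_def)

lemma jordan_power_Suc: "jordan_power P e x (Suc n) = P x (jordan_power P e x n)"
  by (simp add: jordan_power_def)

text \<open>By \<open>prod_triple\<close>, multiplication by the power \<open>n + 2\<close> is
  composed of multiplications by \<open>x\<close>, its square and the powers \<open>n\<close> and
  \<open>n + 1\<close>. The induction therefore carries two consecutive powers.\<close>

lemma linear_commutes_jordan_power:
  assumes T: "linear T" "\<And>v. T (P x v) = P x (T v)" "\<And>v. T (P (P x x) v) = P (P x x) (T v)"
  shows "T (P (jordan_power P e x n) v) = P (jordan_power P e x n) (T v)"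
proof -
  let ?p = "jordan_power P e x"
  have "(\<forall>v. T (P (?p n) v) = P (?p n) (T v)) \<and> (\<forall>v. T (P (?p (Suc n)) v) = P (?p (Suc n)) (T v))"
  proof (induction n)
    case 0
    show ?case
      by (simp add: jordan_power_0 jordan_power_Suc unit unit_right T)
  next
    case (Suc n)
    have "?p (Suc (Suc n)) = P (P x (?p n)) x"
      by (simp add: jordan_power_Suc commute)
    moreover have "P (?p n) x = ?p (Suc n)" "P x (?p n) = ?p (Suc n)"
      by (simp_all add: jordan_power_Suc commute)
    ultimately have "P (?p (Suc (Suc n))) z = P (P x x) (P (?p n) z) + 2 *\<^sub>R P (?p (Suc n)) (P x z)
        - P x (P x (P (?p n) z)) - P (?p n) (P x (P x z))" for z
      using prod_triple[of x "?p n" x z] by (simp add: scaleR_2)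
    then show ?case
      using Suc T by (simp add: linear_add[OF T(1)] linear_diff[OF T(1)] linear_cmul[OF T(1)])
  qed
  then show ?thesis
    by blast
qed

lemma linear_funpow_prod: "linear (P x ^^ n)"
proof (induction n)
  case (Suc n)
  then show ?case
    using linear_compose[OF Suc linear_prod[of x]] by (simp add: o_def)
qed (simp add: linear_iff)

lemma jordan_power_prod_funpow:
  "P (jordan_power P e x m) ((P x ^^ n) v) = (P x ^^ n) (P (jordan_power P e x m) v)"
proof (induction n)
  case (Suc n)
  have "P (jordan_power P e x m) (P x v) = P x (P (jordan_power P e x m) v)" for v
    using linear_commutes_jordan_power[of "P x" x m] by (simp add: linear_prod jordan_identity)
  then show ?case
    by (simp add: Suc)
qed simp

text \<open>By linearity it is enough to take \<open>y\<close> a power of \<open>x\<close>; since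
  multiplications by powers of \<open>x\<close> commute with multiplication by \<open>x\<close>, the
  factors \<open>x\<close> can be pulled out and regrouped.\<close>

lemma jordan_power_prod_span:
  assumes "y \<in> span (range (jordan_power P e x))"
  shows "P (jordan_power P e x m) y = (P x ^^ m) y"
proof -
  have "P (jordan_power P e x m) (jordan_power P e x n) = (P x ^^ m) (jordan_power P e x n)" for n
  proof -
    have "P (jordan_power P e x m) (jordan_power P e x n) = (P x ^^ n) ((P x ^^ m) e)"
      using jordan_power_prod_funpow[of x m n e] by (simp add: jordan_power_def unit_right)
    also have "\<dots> = (P x ^^ m) (jordan_power P e x n)"
      unfolding jordan_power_def by (metis add.commute comp_apply funpow_add)
    finally show ?thesis .
  qed
  then show ?thesis
    using linear_eq_on_span[OF linear_prod linear_funpow_prod _ assms] by blast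
qed

section \<open>Systems of orthogonal idempotents and existence of spectral decompositions\<close>

definition orthogonal_idempotents :: "'a set \<Rightarrow> bool" where
  "orthogonal_idempotents F \<longleftrightarrow> finite F \<and> 0 \<notin> F \<and> (\<forall>c\<in>F. P c c = c) \<and>
    (\<forall>c\<in>F. \<forall>d\<in>F. c \<noteq> d \<longrightarrow> P c d = 0) \<and> \<Sum>F = e"

lemma ex_orthogonal_idempotents_span: "\<exists>F. orthogonal_idempotents F \<and> x \<in> span F"
proof -
  define A where "A = span (range (jordan_power P e x))"
  have A: "subspace A"
    by (simp add: A_def)
  have pow_A: "jordan_power P e x m \<in> A" for m
    by (simp add: A_def span_base)
  have "P x y \<in> A" if "y \<in> A" for y
    using that unfolding A_def
  proof (induction rule: span_induct)
    case base
    show ?case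
      using linear_subspace_vimage[OF linear_prod[of x] A] by (simp add: A_def vimage_def)
  next
    case (step y)
    then obtain n where "y = jordan_power P e x n"
      by blast
    then have "P x y = jordan_power P e x (Suc n)"
      by (simp add: jordan_power_Suc)
    then show ?case
      using pow_A by (simp add: A_def)
  qed
  then obtain B where B: "finite B" "B \<subseteq> A" "0 \<notin> B" "pairwise orthogonal B" "A \<subseteq> span B"
    and eig: "\<forall>b\<in>B. \<exists>l. P x b = l *\<^sub>R b"
    using self_adjoint_eigenbasis[OF linear_prod[of x] A] by (auto simp: inner_assoc image_subset_iff)
  \<comment> \<open>The elements \<open>z\<close> that multiply \<open>b\<close> into its own line
    form a subspace, so powers of \<open>x\<close> suffice. On \<open>A\<close> these act as
    iterates of multiplication by \<open>x\<close>, of which \<open>b\<close> is an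
    eigenvector.\<close>
  have ideal: "\<exists>k. P z b = k *\<^sub>R b" if z: "z \<in> A" and b: "b \<in> B" for z b
    using z unfolding A_def
  proof (induction rule: span_induct)
    case base
    show ?case
    proof (rule subspaceI)
      show "0 \<in> {z. \<exists>k. P z b = k *\<^sub>R b}"
        by (auto simp: prod_simps intro: exI[of _ 0])
      show "u + v \<in> {z. \<exists>k. P z b = k *\<^sub>R b}"
        if "u \<in> {z. \<exists>k. P z b = k *\<^sub>R b}" "v \<in> {z. \<exists>k. P z b = k *\<^sub>R b}" for u v
        using that by (auto simp: prod_simps scaleR_add_left[symmetric])
      show "r *\<^sub>R u \<in> {z. \<exists>k. P z b = k *\<^sub>R b}"
        if "u \<in> {z. \<exists>k. P z b = k *\<^sub>R b}" for u r
        using that by (auto simp: prod_simps)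
    qed
  next
    case (step z)
    then obtain m where z: "z = jordan_power P e x m"
      by blast
    obtain l where l: "P x b = l *\<^sub>R b"
      using eig b by blast
    have "(P x ^^ n) b = l ^ n *\<^sub>R b" for n
      by (induction n) (simp_all add: prod_simps l)
    moreover have "P z b = (P x ^^ m) b"
      unfolding z using B(2) b by (intro jordan_power_prod_span) (auto simp: A_def)
    ultimately have "P z b = l ^ m *\<^sub>R b"
      by simp
    then show ?case
      by blast
  qed
  have "\<forall>b\<in>B. \<exists>k. P b b = k *\<^sub>R b"
    using ideal B(2) by blast
  from bchoice[OF this] obtain k where k: "P b b = k b *\<^sub>R b" if "b \<in> B" for b
    by blast
  have k0: "k b \<noteq> 0" if "b \<in> B" for b
  proof
    assume "k b = 0"
    then have "inner b b = 0"
      using inner_prod_unit[of b b] k[OF that] by simp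
    then show False
      using that B(3) by auto
  qed
  \<comment> \<open>The product lies on the lines of both \<open>b\<close> and \<open>c\<close>,
    which are orthogonal, so it is orthogonal to itself.\<close>
  have orth: "P b c = 0" if bc: "b \<in> B" "c \<in> B" "b \<noteq> c" for b c
  proof -
    obtain s t where st: "P b c = s *\<^sub>R c" "P c b = t *\<^sub>R b"
      using ideal[of b c] ideal[of c b] bc B(2) by blast
    have "inner c b = 0"
      using B(4) bc by (auto simp: pairwise_def orthogonal_def)
    then have "inner (P b c) (P c b) = 0"
      by (simp add: st)
    then show ?thesis
      by (simp add: commute[of c b])
  qed
  \<comment> \<open>As \<open>P b b = k b *\<^sub>R b\<close> with \<open>k b \<noteq> 0\<close>,
    this rescaling makes \<open>b\<close> idempotent.\<close>
  define q where "q b = b /\<^sub>R k b" for b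
  define F where "F = q ` B"
  have FB: "c \<in> F \<longleftrightarrow> (\<exists>b\<in>B. c = b /\<^sub>R k b)" for c
    by (auto simp: F_def q_def)
  have "B \<subseteq> span F"
  proof
    fix b assume b: "b \<in> B"
    then have "b = k b *\<^sub>R q b"
      using k0 by (simp add: q_def)
    then show "b \<in> span F"
      by (metis F_def b image_eqI span_base span_scale)
  qed
  then have AF: "A \<subseteq> span F"
    using B(5) by (meson order_trans span_minimal subspace_span)
  have F: "finite F" "0 \<notin> F" "\<And>c. c \<in> F \<Longrightarrow> P c c = c"
    "\<And>c d. c \<in> F \<Longrightarrow> d \<in> F \<Longrightarrow> c \<noteq> d \<Longrightarrow> P c d = 0"
    using B(1,3) k0 orth by (auto simp: FB F_def[symmetric] prod_simps k) (auto simp: F_def)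
  have "e \<in> span F"
    using AF pow_A[of 0] by (auto simp: jordan_power_0)
  then obtain t where t: "e = (\<Sum>c\<in>F. t c *\<^sub>R c)"
    using span_finite[OF F(1)] by auto
  \<comment> \<open>Multiplying the expansion of the unit by \<open>c\<close> leaves only the term
    of \<open>c\<close>, and the result must be \<open>c\<close> itself.\<close>
  have "t c = 1" if c: "c \<in> F" for c
  proof -
    have "c = P c (\<Sum>d\<in>F. t d *\<^sub>R d)"
      using t unit_right by metis
    also have "\<dots> = (\<Sum>d\<in>F. t d *\<^sub>R P c d)"
      by (simp add: linear_sum[OF linear_prod] prod_simps)
    also have "\<dots> = (\<Sum>d\<in>F. if d = c then t c *\<^sub>R c else 0)"
      using F c by (intro sum.cong) auto
    also have "\<dots> = t c *\<^sub>R c"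
      using F(1) c by simp
    finally have "(1 - t c) *\<^sub>R c = 0"
      by (simp add: algebra_simps)
    then show ?thesis
      using F(2) c by auto
  qed
  then have "\<Sum>F = e"
    using t by simp
  moreover have "x \<in> span F"
    using AF pow_A[of 1] by (auto simp: jordan_power_def unit_right)
  ultimately show ?thesis
    using F unfolding orthogonal_idempotents_def by blast
qed

text \<open>Pairing with the unit turns \<open>P c d = 0\<close> into \<open>inner c d = 0\<close>,
  and nonzero orthogonal vectors are independent.\<close>

lemma orthogonal_idempotents_card_le:
  assumes "orthogonal_idempotents F"
  shows "card F \<le> DIM('a)"
proof -
  have "inner c d = 0" if "c \<in> F" "d \<in> F" "c \<noteq> d" for c d
    using assms that inner_prod_unit[of c d] by (simp add: orthogonal_idempotents_def)
  then have "independent F"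
    using assms by (intro pairwise_orthogonal_independent)
      (auto simp: orthogonal_idempotents_def pairwise_def orthogonal_def)
  then show ?thesis
    using independent_bound by blast
qed

text \<open>Replace \<open>a + b\<close> by its two summands. Idempotence of the sum forces
  \<open>P a b = 0\<close>, and the other members annihilate both summands by
  \<open>idempotent_summand_annihilates\<close>.\<close>

lemma orthogonal_idempotents_split:
  assumes F: "orthogonal_idempotents F" and c: "a + b \<in> F"
    and a: "P a a = a" "a \<noteq> 0" and b: "P b b = b" "b \<noteq> 0"
  shows "\<exists>G. orthogonal_idempotents G \<and> span F \<subseteq> span G \<and> card G = Suc (card F)"
proof -
  let ?F = "F - {a + b}"
  let ?G = "insert a (insert b ?F)"
  have fin: "finite F" and idem: "\<And>d. d \<in> F \<Longrightarrow> P d d = d"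
    and F_orth: "\<And>d f. d \<in> F \<Longrightarrow> f \<in> F \<Longrightarrow> d \<noteq> f \<Longrightarrow> P d f = 0"
    using F by (auto simp: orthogonal_idempotents_def)
  have "P a b + P a b = 0"
    using idem[OF c] a(1) b(1) commute[of b a] by (simp add: prod_simps)
  then have ab: "P a b = 0"
    by (simp add: scaleR_2[symmetric])
  have orth: "P f a = 0" "P f b = 0" if "f \<in> ?F" for f
  proof -
    have "P (a + b) f = 0" "P f f = f"
      using F_orth[OF c] idem that by auto
    then show "P f a = 0" "P f b = 0"
      using idempotent_summand_annihilates[OF a(1) b(1)] idempotent_summand_annihilates[OF b(1) a(1)]
      by (auto simp: add.commute)
  qed
  have ba: "P b a = 0"
    using ab commute[of b a] by simp
  have orth': "P a f = 0" "P b f = 0" if "f \<in> ?F" for f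
    using orth[OF that] commute[of a f] commute[of b f] by auto
  have notin: "a \<notin> ?F" "b \<notin> ?F" "a \<noteq> b"
    using orth[of a] orth[of b] ab a b by auto
  have "card ?G = Suc (Suc (card ?F))"
    using fin notin by simp
  also have "\<dots> = Suc (card F)"
    using card_Suc_Diff1[OF fin c] by simp
  finally have "card ?G = Suc (card F)" .
  moreover have "\<Sum>?G = e"
  proof -
    have "\<Sum>?G = a + b + \<Sum>?F"
      using fin notin by (simp add: add.assoc)
    also have "\<dots> = \<Sum>F"
      using sum.remove[OF fin c, of "\<lambda>x. x"] by simp
    finally show ?thesis
      using F by (simp add: orthogonal_idempotents_def)
  qed
  moreover have "span F \<subseteq> span ?G"
  proof (rule span_minimal)
    have "a + b \<in> span ?G"
      by (intro span_add span_base) auto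
    moreover have "d \<in> span ?G" if "d \<in> F" "d \<noteq> a + b" for d
      using that by (intro span_base) auto
    ultimately show "F \<subseteq> span ?G"
      by blast
  qed simp
  moreover have "P c d = 0" if "c \<in> ?G" "d \<in> ?G" "c \<noteq> d" for c d
    using that orth orth' F_orth ab ba by (elim insertE) auto
  then have "orthogonal_idempotents ?G"
    using F idem a b \<open>\<Sum>?G = e\<close> unfolding orthogonal_idempotents_def by blast
  ultimately show ?thesis
    by blast
qed

lemma ex_spectral_decomposition: "\<exists>k l c. spectral_decomposition P e x k l c"
proof -
  let ?Q = "\<lambda>F. orthogonal_idempotents F \<and> x \<in> span F"
  obtain F0 where F0: "?Q F0"
    using ex_orthogonal_idempotents_span by blast
  have "\<forall>F. ?Q F \<longrightarrow> card F < Suc DIM('a)"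
    by (simp add: orthogonal_idempotents_card_le less_Suc_eq_le)
  from ex_has_greatest_nat[OF F0 this]
  obtain F where F: "?Q F" and max: "\<And>G. ?Q G \<Longrightarrow> card G \<le> card F"
    by auto
  then have fin: "finite F"
    by (simp add: orthogonal_idempotents_def)
  \<comment> \<open>A member that splits would give a larger system whose span still contains
    \<open>x\<close>, against maximality of \<open>F\<close>.\<close>
  have prim: "primitive_idempotent P c" if c: "c \<in> F" for c
    unfolding primitive_idempotent_def jordan_idempotent_def
  proof (intro conjI notI)
    show "P c c = c" "c = 0 \<Longrightarrow> False"
      using F that by (auto simp: orthogonal_idempotents_def)
    assume "\<exists>a b. P a a = a \<and> P b b = b \<and> a \<noteq> 0 \<and> b \<noteq> 0 \<and> c = a + b"
    then obtain a b where "P a a = a" "P b b = b" "a \<noteq> 0" "b \<noteq> 0" "a + b \<in> F"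
      using c by blast
    then obtain G where "orthogonal_idempotents G" "span F \<subseteq> span G" "card G = Suc (card F)"
      using orthogonal_idempotents_split[of F a b] F by blast
    then show False
      using max[of G] F by auto
  qed
  obtain u where u: "x = (\<Sum>c\<in>F. u c *\<^sub>R c)"
    using F span_finite[OF fin] by auto
  obtain h where h: "bij_betw h {..<card F} F"
    using ex_bij_betw_nat_finite[OF fin] by (auto simp: atLeast0LessThan)
  have hF: "h i \<in> F" if "i < card F" for i
    using h that bij_betwE by fastforce
  have "jordan_frame P e (card F) h"
    unfolding jordan_frame_def
  proof (intro conjI allI impI)
    show "primitive_idempotent P (h i)" if "i < card F" for i
      using prim hF that by blast
    show "P (h i) (h j) = 0" if "i < card F" "j < card F" "i \<noteq> j" for i j
    proof -
      have "h i \<noteq> h j"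
        using h that by (auto simp: bij_betw_def inj_on_def)
      then show ?thesis
        using F hF that by (auto simp: orthogonal_idempotents_def)
    qed
    show "(\<Sum>i<card F. h i) = e"
      using sum.reindex_bij_betw[OF h, of "\<lambda>c. c"] F by (simp add: orthogonal_idempotents_def)
  qed
  moreover have "x = (\<Sum>i<card F. u (h i) *\<^sub>R h i)"
    using sum.reindex_bij_betw[OF h, of "\<lambda>c. u c *\<^sub>R c"] u by simp
  ultimately have "spectral_decomposition P e x (card F) (\<lambda>i. u (h i)) h"
    by (simp add: spectral_decomposition_def)
  then show ?thesis
    by blast
qed

section \<open>Functional calculus in a Jordan frame\<close>

lemma prod_sum_right: "P x (\<Sum>i\<in>I. f i) = (\<Sum>i\<in>I. P x (f i))"
  by (rule linear_sum[OF linear_prod])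

lemma prod_sum_left: "P (\<Sum>i\<in>I. f i) x = (\<Sum>i\<in>I. P (f i) x)"
  using prod_sum_right[of x f I] by (simp add: commute[of x])

lemma jordan_frame_idempotent: "jordan_frame P e k c \<Longrightarrow> i < k \<Longrightarrow> P (c i) (c i) = c i"
  by (simp add: jordan_frame_def primitive_idempotent_def jordan_idempotent_def)

lemma jordan_frame_nonzero: "jordan_frame P e k c \<Longrightarrow> i < k \<Longrightarrow> c i \<noteq> 0"
  by (simp add: jordan_frame_def primitive_idempotent_def)

lemma jordan_frame_orthogonal:
  "jordan_frame P e k c \<Longrightarrow> i < k \<Longrightarrow> j < k \<Longrightarrow> i \<noteq> j \<Longrightarrow> P (c i) (c j) = 0"
  by (simp add: jordan_frame_def)

lemma jordan_frame_sum: "jordan_frame P e k c \<Longrightarrow> (\<Sum>i<k. c i) = e"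
  by (simp add: jordan_frame_def)

lemma jordan_frame_eigen:
  assumes "jordan_frame P e k c" "j < k"
  shows "P (\<Sum>i<k. l i *\<^sub>R c i) (c j) = l j *\<^sub>R c j"
proof -
  have "P (\<Sum>i<k. l i *\<^sub>R c i) (c j) = (\<Sum>i<k. if i = j then l j *\<^sub>R c j else 0)"
    unfolding prod_sum_left using assms
    by (intro sum.cong) (auto simp: prod_simps jordan_frame_idempotent jordan_frame_orthogonal)
  then show ?thesis
    using assms(2) by simp
qed

lemma jordan_frame_prod:
  assumes "jordan_frame P e k c"
  shows "P (\<Sum>i<k. l i *\<^sub>R c i) (\<Sum>i<k. m i *\<^sub>R c i) = (\<Sum>i<k. (l i * m i) *\<^sub>R c i)"
  unfolding prod_sum_right[of _ "\<lambda>i. m i *\<^sub>R c i"]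
  by (intro sum.cong refl) (simp add: prod_simps jordan_frame_eigen[OF assms] mult.commute)

text \<open>In the linearized identity at \<open>c\<close>, \<open>c\<close>, \<open>d\<close> every
  term containing \<open>P c d\<close> drops out; the two that remain are the two sides.\<close>

lemma orthogonal_idempotent_prod_commute:
  assumes "P c c = c" "P c d = 0"
  shows "P c (P d z) = P d (P c z)"
  using jordan_identity_linearized[of c c d z] commute[of d c] assms by (simp add: prod_simps)

lemma jordan_frame_prod_commute:
  assumes "jordan_frame P e k c"
  shows "P (\<Sum>i<k. l i *\<^sub>R c i) (P (\<Sum>i<k. m i *\<^sub>R c i) z)
    = P (\<Sum>i<k. m i *\<^sub>R c i) (P (\<Sum>i<k. l i *\<^sub>R c i) z)"
proof -
  have "P (c i) (P (c j) z) = P (c j) (P (c i) z)" if "i < k" "j < k" for i j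
    using orthogonal_idempotent_prod_commute jordan_frame_idempotent[OF assms]
      jordan_frame_orthogonal[OF assms] that by (cases "i = j") auto
  then have "(\<Sum>i<k. \<Sum>j<k. (m i * l j) *\<^sub>R P (c j) (P (c i) z))
    = (\<Sum>i<k. \<Sum>j<k. (l i * m j) *\<^sub>R P (c j) (P (c i) z))"
    by (subst sum.swap) (intro sum.cong refl, simp add: mult.commute)
  then show ?thesis
    by (simp add: prod_sum_left prod_sum_right prod_simps scaleR_sum_right)
qed

text \<open>
  If \<open>l i \<noteq> m j\<close>, then \<open>c i\<close> and \<open>d j\<close> are orthogonal, being eigenvectors of the
  self-adjoint multiplication by \<open>u\<close> for different eigenvalues. Hence the difference of the two sides is
  orthogonal to every \<open>c i\<close> and, by symmetry, to every \<open>d j\<close>.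
\<close>

lemma spectral_decomposition_unique:
  assumes "spectral_decomposition P e u k l c" "spectral_decomposition P e u n m d"
  shows "(\<Sum>i<k. f (l i) *\<^sub>R c i) = (\<Sum>j<n. f (m j) *\<^sub>R d j)"
proof -
  have orth: "inner (c i) (\<Sum>i<k. f (l i) *\<^sub>R c i) = inner (c i) (\<Sum>j<n. f (m j) *\<^sub>R d j)"
    if sc: "spectral_decomposition P e u k l c" and sd: "spectral_decomposition P e u n m d"
      and i: "i < k" for k n i and l m :: "nat \<Rightarrow> real" and c d
  proof -
    have c: "jordan_frame P e k c" and uc: "u = (\<Sum>i<k. l i *\<^sub>R c i)"
      and d: "jordan_frame P e n d" and ud: "u = (\<Sum>j<n. m j *\<^sub>R d j)"
      using sc sd by (auto simp: spectral_decomposition_def)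
    have "inner (c i) (\<Sum>i<k. f (l i) *\<^sub>R c i) = inner (P (\<Sum>i<k. f (l i) *\<^sub>R c i) (c i)) e"
      by (simp only: inner_prod_unit) (rule inner_commute)
    also have "\<dots> = f (l i) * inner (c i) e"
      by (simp add: jordan_frame_eigen[OF c i])
    also have "\<dots> = (\<Sum>j<n. f (l i) * inner (c i) (d j))"
      by (simp add: jordan_frame_sum[OF d, symmetric] inner_sum_right sum_distrib_left)
    also have "\<dots> = (\<Sum>j<n. f (m j) * inner (c i) (d j))"
    proof (rule sum.cong)
      fix j assume "j \<in> {..<n}"
      then have "inner (P u (c i)) (d j) = l i * inner (c i) (d j)"
        "inner (c i) (P u (d j)) = m j * inner (c i) (d j)"
        using jordan_frame_eigen[OF c i, of l] jordan_frame_eigen[OF d, of j m] uc ud by auto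
      then show "f (l i) * inner (c i) (d j) = f (m j) * inner (c i) (d j)"
        by (cases "inner (c i) (d j) = 0") (auto simp: inner_assoc)
    qed simp
    finally show ?thesis
      by (simp add: inner_sum_right)
  qed
  let ?x = "\<Sum>i<k. f (l i) *\<^sub>R c i" and ?y = "\<Sum>j<n. f (m j) *\<^sub>R d j"
  have "inner ?x (?x - ?y) = 0" "inner ?y (?x - ?y) = 0"
    using orth[OF assms] orth[OF assms(2,1)] by (simp_all add: inner_diff_right inner_sum_left)
  then have "inner (?x - ?y) (?x - ?y) = 0"
    by (simp add: inner_diff_left)
  then show ?thesis
    by simp
qed

lemma jordan_apply_eq:
  assumes "spectral_decomposition P e u k l c"
  shows "jordan_apply P e f u = (\<Sum>i<k. f (l i) *\<^sub>R c i)"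
  unfolding jordan_apply_def
  by (rule the_equality) (use assms spectral_decomposition_unique in blast)+

text \<open>For small \<open>s > 0\<close>, \<open>w - s *\<^sub>R e\<close> is still a square. Its
  inner product with the idempotent \<open>c i\<close> is nonnegative and equals
  \<open>(l i - s) * inner (c i) (c i)\<close>.\<close>

lemma interior_cone_of_squares_eigenvalue_pos:
  assumes w: "w \<in> interior (cone_of_squares P)" and sw: "spectral_decomposition P e w k l c" and i: "i < k"
  shows "l i > 0"
proof -
  have c: "jordan_frame P e k c" and w_eq: "w = (\<Sum>i<k. l i *\<^sub>R c i)"
    using sw by (auto simp: spectral_decomposition_def)
  obtain r where r: "r > 0" "ball w r \<subseteq> cone_of_squares P"
    using w by (auto simp: mem_interior)
  \<comment> \<open>Chosen so that \<open>s * norm e \<le> r / 2\<close>; the summand 1 keeps the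
    denominator positive.\<close>
  define s where "s = r / (2 * (norm e + 1))"
  have s: "s > 0"
    using r(1) by (simp add: s_def add_nonneg_pos)
  have "s * norm e < r"
  proof -
    have "s * norm e \<le> s * (norm e + 1)"
      using s by simp
    also have "\<dots> = r / 2"
      unfolding s_def using norm_ge_zero[of e] by (simp add: field_simps add_nonneg_eq_0_iff)
    finally show ?thesis
      using r(1) by simp
  qed
  then have "w - s *\<^sub>R e \<in> ball w r"
    using s by (simp add: dist_norm)
  then have "w - s *\<^sub>R e \<in> cone_of_squares P"
    using r(2) by blast
  then obtain v where v: "w - s *\<^sub>R e = P v v"
    unfolding cone_of_squares_def by blast
  have "0 \<le> inner v (P (c i) v)"
    by (rule inner_idempotent_prod_nonneg[OF jordan_frame_idempotent[OF c i]])
  also have "\<dots> = inner (P v v) (c i)"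
    by (simp add: inner_assoc commute[of "c i"])
  also have "\<dots> = inner (P (w - s *\<^sub>R e) (c i)) e"
    by (simp only: inner_prod_unit v)
  also have "\<dots> = (l i - s) * inner (c i) (c i)"
    using jordan_frame_eigen[OF c i, of l] inner_prod_unit[of "c i" "c i"] jordan_frame_idempotent[OF c i]
    by (simp add: prod_simps unit w_eq inner_diff_left algebra_simps)
  finally have "0 \<le> (l i - s) * inner (c i) (c i)" .
  moreover have "0 < inner (c i) (c i)"
    using jordan_frame_nonzero[OF c i] by simp
  ultimately have "0 \<le> l i - s"
    unfolding zero_le_mult_iff by linarith
  then show ?thesis
    using s by simp
qed

section \<open>The quadratic representation at square roots\<close>

lemma linear_jordan_quad: "linear (jordan_quad P a)"
  by (simp add: linear_iff jordan_quad_def prod_simps algebra_simps)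

lemma inner_jordan_quad: "inner (jordan_quad P a x) y = inner x (jordan_quad P a y)"
  by (simp add: jordan_quad_def inner_diff_left inner_diff_right inner_assoc)

lemma jordan_quad_unit: "jordan_quad P a e = P a a"
  by (simp add: jordan_quad_def unit_right scaleR_2)

text \<open>With \<open>Q\<close> for \<open>jordan_quad P\<close>, the two intermediate facts are
  that \<open>P a\<close> after \<open>Q b\<close> is \<open>P b\<close>, and that
  \<open>P (P a a)\<close> after \<open>Q b\<close> is \<open>2 P a P b\<close> minus the identity.
  In the definition of \<open>Q a\<close> the double products then cancel. The commutation
  hypotheses hold for elements sharing a frame.\<close>

lemma jordan_quad_inverse:
  assumes ab: "P a b = e" and aab: "P (P a a) b = a" and abb: "P (P b b) a = b"
    and aabb: "P (P a a) (P b b) = e"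
    and comm: "\<And>z. P a (P b z) = P b (P a z)" "\<And>z. P (P a a) (P b z) = P b (P (P a a) z)"
      "\<And>z. P a (P (P b b) z) = P (P b b) (P a z)" "\<And>z. P (P a a) (P (P b b) z) = P (P b b) (P (P a a) z)"
  shows "jordan_quad P a (jordan_quad P b z) = z"
proof -
  have ba: "P b a = e"
    using ab commute by metis
  have 1: "P a (jordan_quad P b v) = P b v" for v
  proof -
    \<comment> \<open>Writing \<open>b\<close> as a triple product makes \<open>prod_triple\<close>
      applicable; \<open>P b a = e\<close> then simplifies the expansion.\<close>
    have "P b v = P (P (P b b) a) v"
      by (simp add: abb)
    also have "\<dots> = 2 *\<^sub>R P b v - 2 *\<^sub>R P a (P b (P b v)) + P a (P (P b b) v)"
      unfolding prod_triple[of b b a v]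
      by (simp add: ba unit comm scaleR_2)
    finally show ?thesis
      by (simp add: jordan_quad_def prod_simps scaleR_2 algebra_simps)
  qed
  have 2: "P (P a a) (jordan_quad P b v) = 2 *\<^sub>R P a (P b v) - v" for v
  proof -
    \<comment> \<open>Here the unit is the triple product, since \<open>P b (P a a) = a\<close> and
      \<open>P a b = e\<close>.\<close>
    have "v = P (P (P b (P a a)) b) v"
      using aab ab commute[of b "P a a"] by (simp add: unit)
    also have "\<dots> = 2 *\<^sub>R P a (P b v) - (2 *\<^sub>R P (P a a) (P b (P b v)) - P (P a a) (P (P b b) v))"
      unfolding prod_triple[of b "P a a" b v]
      using aab commute[of b "P a a"] by (simp add: comm scaleR_2)
    finally have "v = 2 *\<^sub>R P a (P b v) - P (P a a) (jordan_quad P b v)"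
      by (simp add: jordan_quad_def prod_simps)
    moreover have "y = x - v" if "v = x - y" for x y
      using that by simp
    ultimately show ?thesis
      by blast
  qed
  show ?thesis
    unfolding jordan_quad_def[of P a] 1 2 by simp
qed

lemma
  assumes "w \<in> interior (cone_of_squares P)"
  shows quad_sqrt_quad_inv_sqrt:
      "jordan_quad P (jordan_sqrt P e w) (jordan_quad P (jordan_inv_sqrt P e w) z) = z"
    and quad_inv_sqrt_quad_sqrt:
      "jordan_quad P (jordan_inv_sqrt P e w) (jordan_quad P (jordan_sqrt P e w) z) = z"
    and sqrt_prod_sqrt: "P (jordan_sqrt P e w) (jordan_sqrt P e w) = w"
    and inv_sqrt_prod_inv_sqrt: "P (jordan_inv_sqrt P e w) (jordan_inv_sqrt P e w) = jordan_inv P e w"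
proof -
  obtain k l c where sw: "spectral_decomposition P e w k l c"
    using ex_spectral_decomposition by blast
  then have c: "jordan_frame P e k c" and w: "w = (\<Sum>i<k. l i *\<^sub>R c i)"
    by (auto simp: spectral_decomposition_def)
  note pos = interior_cone_of_squares_eigenvalue_pos[OF assms sw]
  \<comment> \<open>All functions of \<open>w\<close> are evaluated in one frame, so products become
    pointwise and multiplications commute. Positive eigenvalues make agreement of functions on the
    positive reals sufficient.\<close>
  define S where "S f = (\<Sum>i<k. f (l i) *\<^sub>R c i)" for f :: "real \<Rightarrow> real"
  have S_cong: "S f = S g" if "\<And>t. t > 0 \<Longrightarrow> f t = g t" for f g
    unfolding S_def using that pos by (intro sum.cong) auto
  have S_prod: "P (S f) (S g) = S (\<lambda>t. f t * g t)" for f g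
    unfolding S_def by (rule jordan_frame_prod[OF c])
  have S_comm: "P (S f) (P (S g) z) = P (S g) (P (S f) z)" for f g z
    unfolding S_def by (rule jordan_frame_prod_commute[OF c])
  have one: "S (\<lambda>t. 1) = e"
    by (simp add: S_def jordan_frame_sum[OF c])
  have sqrt: "jordan_sqrt P e w = S sqrt"
    and inv_sqrt: "jordan_inv_sqrt P e w = S (\<lambda>t. inverse (sqrt t))"
    and inv: "jordan_inv P e w = S inverse"
    by (simp_all add: jordan_sqrt_def jordan_inv_sqrt_def jordan_inv_def jordan_apply_eq[OF sw] S_def)
  have SS: "P (S sqrt) (S sqrt) = S (\<lambda>t. t)"
    and II: "P (S (\<lambda>t. inverse (sqrt t))) (S (\<lambda>t. inverse (sqrt t))) = S inverse"
    and SI: "P (S sqrt) (S (\<lambda>t. inverse (sqrt t))) = e"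
    and SSI: "P (S (\<lambda>t. t)) (S (\<lambda>t. inverse (sqrt t))) = S sqrt"
    and IIS: "P (S inverse) (S sqrt) = S (\<lambda>t. inverse (sqrt t))"
    and SSII: "P (S (\<lambda>t. t)) (S inverse) = e"
    unfolding S_prod one[symmetric] by (rule S_cong, simp add: field_simps flip: real_sqrt_mult)+
  have IS: "P (S (\<lambda>t. inverse (sqrt t))) (S sqrt) = e" and IISS: "P (S inverse) (S (\<lambda>t. t)) = e"
    using SI SSII commute by metis+
  show "P (jordan_sqrt P e w) (jordan_sqrt P e w) = w"
    unfolding sqrt SS by (simp add: S_def w)
  show "P (jordan_inv_sqrt P e w) (jordan_inv_sqrt P e w) = jordan_inv P e w"
    unfolding inv_sqrt inv by (rule II)
  show "jordan_quad P (jordan_sqrt P e w) (jordan_quad P (jordan_inv_sqrt P e w) z) = z"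
    unfolding sqrt inv_sqrt by (rule jordan_quad_inverse; (unfold SS II)?; fact SI SSI IIS SSII S_comm)
  show "jordan_quad P (jordan_inv_sqrt P e w) (jordan_quad P (jordan_sqrt P e w) z) = z"
    unfolding sqrt inv_sqrt by (rule jordan_quad_inverse; (unfold SS II)?; fact IS IIS SSI IISS S_comm)
qed

end

section \<open>Orthogonal projection and the Newton direction\<close>

lemma orth_proj_in:
  assumes "subspace S"
  shows "orth_proj S x \<in> S" "x - orth_proj S x \<in> orthogonal_comp S"
proof -
  have "\<exists>!p. p \<in> S \<and> x - p \<in> orthogonal_comp S"
  proof (rule ex_ex1I)
    obtain y z where "y \<in> S" "\<And>w. w \<in> S \<Longrightarrow> orthogonal z w" "x = y + z"
      using orthogonal_subspace_decomp_exists[of S x] assms by (metis span_eq_iff)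
    then show "\<exists>p. p \<in> S \<and> x - p \<in> orthogonal_comp S"
      by (intro exI[of _ y]) (auto simp: orthogonal_comp_def orthogonal_commute)
  next
    fix p q assume p: "p \<in> S \<and> x - p \<in> orthogonal_comp S" and q: "q \<in> S \<and> x - q \<in> orthogonal_comp S"
    then have "p - q \<in> S"
      \<comment> \<open>Both residuals are orthogonal to \<open>p - q\<close>, hence so is their
        difference, which is \<open>p - q\<close> itself.\<close>
      using assms by (simp add: subspace_diff)
    then have "inner (p - q) (x - q) = 0" "inner (p - q) (x - p) = 0"
      using p q by (auto simp: orthogonal_comp_def orthogonal_def)
    then have "inner (p - q) (p - q) = 0"
      by (simp add: inner_diff_right)
    then show "p = q"
      by simp
  qed
  from theI'[OF this] show "orth_proj S x \<in> S" "x - orth_proj S x \<in> orthogonal_comp S"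
    by (simp_all add: orth_proj_def)
qed

theorem proposition2p4:
  fixes P :: "'a::euclidean_space \<Rightarrow> 'a \<Rightarrow> 'a" and e :: 'a and n :: nat
    and L :: "'a set" and x0 s0 w d1 d2 :: 'a and \<mu> :: real
  assumes "trace_euclidean_jordan_algebra P e" and "jordan_rank P e = n"
    and "subspace L"
    and "interior (cone_of_squares P) \<inter> affine_translate x0 L \<noteq> {}"
    and "interior (cone_of_squares P) \<inter> affine_translate s0 (orthogonal_comp L) \<noteq> {}"
    and "\<mu> > 0" and "w \<in> interior (cone_of_squares P)"
    and "d1 = orth_proj (orthogonal_comp (scaled_subspace P e L w))
                (jordan_quad P (jordan_inv_sqrt P e w) ((1 / sqrt \<mu>) *\<^sub>R x0 - w))"
    and "d2 = orth_proj (scaled_subspace P e L w)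
                (jordan_quad P (jordan_sqrt P e w) ((1 / sqrt \<mu>) *\<^sub>R s0 - jordan_inv P e w))"
  shows "newton_direction P e L x0 s0 w \<mu> = d1 - d2"
proof -
  interpret trace_euclidean_jordan_algebra P e
    by (rule assms(1))
  define Qa where "Qa = jordan_quad P (jordan_sqrt P e w)"
  define Qb where "Qb = jordan_quad P (jordan_inv_sqrt P e w)"
  define x where "x = (1 / sqrt \<mu>) *\<^sub>R x0"
  define s where "s = (1 / sqrt \<mu>) *\<^sub>R s0"
  define S where "S = scaled_subspace P e L w"
  have lin: "linear Qa" "linear Qb"
    by (simp_all add: Qa_def Qb_def linear_jordan_quad)
  have Qab: "Qa (Qb z) = z" and Qba: "Qb (Qa z) = z" for z
    using quad_sqrt_quad_inv_sqrt[OF assms(7)] quad_inv_sqrt_quad_sqrt[OF assms(7)]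
    by (simp_all add: Qa_def Qb_def)
  have Qae: "Qa e = w" and Qbe: "Qb e = jordan_inv P e w"
    using sqrt_prod_sqrt[OF assms(7)] inv_sqrt_prod_inv_sqrt[OF assms(7)]
    by (simp_all add: Qa_def Qb_def jordan_quad_unit)
  have S_image: "S = Qb ` L"
    by (auto simp: S_def scaled_subspace_def Qb_def)
  have subS: "subspace S"
    unfolding S_image by (rule linear_subspace_image[OF lin(2) assms(3)])
  have subC: "subspace (orthogonal_comp S)"
    by (rule subspace_orthogonal_comp)
  have memS: "z \<in> S \<longleftrightarrow> Qa z \<in> L" for z
    unfolding S_image using Qab Qba by (metis image_iff)
  \<comment> \<open>Self-adjointness moves \<open>Qb\<close> from the elements of \<open>L\<close>
    onto \<open>z\<close>.\<close>
  have memC: "z \<in> orthogonal_comp S \<longleftrightarrow> Qb z \<in> orthogonal_comp L" for z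
    by (simp add: S_image orthogonal_comp_def orthogonal_def Qb_def inner_jordan_quad)
  have trans: "z \<in> affine_translate v U \<longleftrightarrow> z - v \<in> U" for z v :: 'a and U
    by (force simp: affine_translate_def)
  define p where "p = Qb (x - w)"
  define q where "q = Qa (s - jordan_inv P e w)"
  have p: "Qa p = x - w" and q: "Qb q = s - jordan_inv P e w"
    by (simp_all add: p_def q_def Qab Qba)
  \<comment> \<open>Since \<open>Qa e = w\<close> and \<open>Qa p = x - w\<close>, the difference
    \<open>Qa (e + d) - x\<close> is \<open>Qa (d - p)\<close>.\<close>
  have cond1: "Qa (e + d) \<in> affine_translate x L \<longleftrightarrow> d - p \<in> S" for d
    by (simp add: trans memS linear_add[OF lin(1)] linear_diff[OF lin(1)] Qae p algebra_simps)
  have cond2: "Qb (e - d) \<in> affine_translate s (orthogonal_comp L) \<longleftrightarrow> d + q \<in> orthogonal_comp S" for d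
  proof -
    have "Qb (e - d) - s = - Qb (d + q)"
      by (simp add: linear_add[OF lin(2)] linear_diff[OF lin(2)] Qbe q)
    then show ?thesis
      using subspace_orthogonal_comp[of L] by (metis trans memC subspace_neg minus_minus)
  qed
  have d1: "d1 = orth_proj (orthogonal_comp S) p" and d2: "d2 = orth_proj S q"
    using assms(8,9) by (simp_all add: p_def q_def S_def x_def s_def Qa_def Qb_def)
  \<comment> \<open>The residual \<open>p - d1\<close> lies in the double orthogonal complement of
    \<open>S\<close>, which is \<open>S\<close>.\<close>
  have "d1 \<in> orthogonal_comp S" "p - d1 \<in> S" "d2 \<in> S" "q - d2 \<in> orthogonal_comp S"
    using orth_proj_in[OF subC, of p] orth_proj_in[OF subS, of q] orthogonal_comp_self[OF subS]
    by (simp_all add: d1 d2)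
  then have sol: "(d1 - d2) - p \<in> S" "(d1 - d2) + q \<in> orthogonal_comp S"
    using subspace_neg[OF subS, of "p - d1"] subspace_diff[OF subS, of "d1 - p" d2]
      subspace_add[OF subC, of d1 "q - d2"]
    by (simp_all add: algebra_simps)
  show ?thesis
    unfolding newton_direction_def Qa_def[symmetric] Qb_def[symmetric] x_def[symmetric] s_def[symmetric]
      cond1 cond2
  proof (rule the_equality)
    show "d1 - d2 - p \<in> S \<and> d1 - d2 + q \<in> orthogonal_comp S"
      using sol by simp
    fix d assume d: "d - p \<in> S \<and> d + q \<in> orthogonal_comp S"
    \<comment> \<open>Two solutions differ by an element of both \<open>S\<close> and its orthogonal
      complement, hence by 0.\<close>
    have "d - (d1 - d2) \<in> S" "d - (d1 - d2) \<in> orthogonal_comp S"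
      using d sol subspace_diff[OF subS, of "d - p" "d1 - d2 - p"]
        subspace_diff[OF subC, of "d + q" "d1 - d2 + q"] by simp_all
    then have "inner (d - (d1 - d2)) (d - (d1 - d2)) = 0"
      by (simp add: orthogonal_comp_def orthogonal_def)
    then show "d = d1 - d2"
      by simp
  qed
qed

end
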